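(* Let $0<R\le1$ and let $f$ be analytic and non-vanishing on the closed disk $|z|\le R$, and suppose $f(z)=\prod_{n=2}^{\infty}(1-z^n)^{\alpha_n}$ with the product converging compactly on $|z|<R$ (with $\alpha_n\in\mathbb C$). Let $B$ be an upper bound for $|f'(z)/f(z)|$ on $|z|=R$. Let $m$ be a positive integer with $Rp_m>1$, and let $M>m$ be an integer such that $$C(R,B,m,M):=\frac{(e-1)Bp_m}{Rp_m-1}\cdot\frac{1}{(Rp_m)^M}\le 1.$$ Then $$\Bigl|\prod_{k=m}^{\infty}f(1/p_k)-\prod_{n=2}^{M}\zeta_m(n)^{-\alpha_n}\Bigr|\le C(R,B,m,M)\,\Bigl|\prod_{n=2}^{M}\zeta_m(n)^{-\alpha_n}\Bigr|.$$
   Context: $p_k$ denotes the $k$-th prime number. For real $s>1$, $\zeta_m(s)=\prod_{k=m}^{\infty}(1-p_k^{-s})^{-1}=\zeta(s)\prod_{k=1}^{m-1}(1-p_k^{-s})$, a partial Riemann zeta function; $\zeta_m(n)^{-\alpha_n}=e^{-\alpha_n\ln\zeta_m(n)}$ with the real logarithm. For complex $\alpha$ and $|z|<1$, $(1-z^n)^{\alpha}=e^{\alpha\,\mathrm{Log}(1-z^n)}$ with $\mathrm{Log}$ the principal branch. *)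

theory Defs
  imports "HOL-Complex_Analysis.Complex_Analysis" "HOL-Computational_Algebra.Primes"
begin

text \<open>The primes are indexed from 1, so \<^term>\<open>nth_prime 1 = 2\<close>; the index 0 is never used.\<close>

definition nth_prime :: "nat \<Rightarrow> nat" where
  "nth_prime k = enumerate {p. prime p} (k - 1)"

text \<open>The Euler product over the primes \<^term>\<open>nth_prime k\<close> with \<open>k \<ge> m\<close>, for real \<open>s > 1\<close>.\<close>

definition partial_zeta :: "nat \<Rightarrow> real \<Rightarrow> real" where
  "partial_zeta m s = (\<Prod>k. inverse (1 - real (nth_prime (m + k)) powr (- s)))"

definition zeta_prod :: "(nat \<Rightarrow> complex) \<Rightarrow> nat \<Rightarrow> nat \<Rightarrow> complex" where
  "zeta_prod \<alpha> m M =
     (\<Prod>n = 2..M. exp (- \<alpha> n * complex_of_real (ln (partial_zeta m (real n)))))"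

text \<open>
  Locally uniform convergence of the partial products to \<open>f\<close> on \<open>|z| < R\<close>. For \<open>R \<le> 1\<close> no factor
  vanishes on this disk, so for a non-vanishing \<open>f\<close> this is compact convergence of the infinite
  product also under the convention that its limit be nonzero. On complex numbers
  \<open>powr\<close> uses the principal branch of the logarithm.
\<close>

definition product_converges_compactly ::
    "(nat \<Rightarrow> complex) \<Rightarrow> real \<Rightarrow> (complex \<Rightarrow> complex) \<Rightarrow> bool" where
  "product_converges_compactly \<alpha> R f \<longleftrightarrow>
     (\<forall>K. compact K \<longrightarrow> K \<subseteq> ball 0 R \<longrightarrow>
        uniform_limit K (\<lambda>N z. \<Prod>n = 2..N. (1 - z ^ n) powr \<alpha> n) f sequentially)"

definition error_const :: "real \<Rightarrow> real \<Rightarrow> nat \<Rightarrow> nat \<Rightarrow> real" where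
  "error_const R B m M =
     (exp 1 - 1) * B * real (nth_prime m) / (R * real (nth_prime m) - 1)
       * (1 / (R * real (nth_prime m)) ^ M)"

end

theory Submission
  imports Defs
begin

text \<open>
  Expanding the logarithmic derivative gives \<open>f'(z)/f(z) = - \<Sum>\<^sub>N c\<^sub>N z\<^bsup>N-1\<^esup>\<close> with
  \<open>c\<^sub>N = \<Sum>\<^bsub>d | N\<^esub> d \<alpha>\<^sub>d\<close>. Cauchy's inequality bounds \<open>c\<^sub>N\<close> by \<open>B / R\<^bsup>N-1\<^esup>\<close>, and
  inverting the divisor sum yields \<open>|\<alpha>\<^sub>n| \<le> B / R\<^bsup>n-1\<^esup>\<close>. With \<open>p = p\<^sub>m\<close>, comparison with a
  telescoping sum gives \<open>ln \<zeta>\<^sub>m(n) \<le> 1 / p\<^bsup>n-1\<^esup>\<close> for \<open>n \<ge> 3\<close>. Hence the logarithm of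
  the product over the primes can be summed in either order, its terms with \<open>n > M\<close> contribute some
  \<open>W\<close> with \<open>|W|\<close> at most the geometric series \<open>\<Sum>\<^bsub>n>M\<^esub> B / (R p)\<^bsup>n-1\<^esup>\<close>, and the relative error
  is \<open>|e\<^sup>W - 1| \<le> (e - 1) |W|\<close>.
\<close>

section \<open>Recovering a function from its divisor sums\<close>

text \<open>
  By Moebius inversion, \<open>g n\<close> is a signed sum of divisor sums, one for each squarefree divisor of
  \<open>n\<close>. Removing one prime at a time from \<open>n\<close> costs a factor 2 each, so the number of
  terms is at most \<open>n\<close>, and no Moebius function is needed.
\<close>

lemma norm_le_of_divisor_sums:
  fixes g :: "nat \<Rightarrow> 'a::real_normed_vector"
  assumes "n > 0" and "\<And>N. N dvd n \<Longrightarrow> norm (\<Sum>d | d dvd N. g d) \<le> K"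
  shows "norm (g n) \<le> real n * K"
  using assms
proof (induction n arbitrary: g K rule: less_induct)
  case (less n)
  have K: "K \<ge> 0"
    using less.prems(2)[of 1] norm_ge_zero by (metis one_dvd order_trans)
  show ?case
  proof (cases "n = 1")
    case True
    then show ?thesis using less.prems(2)[of 1] by simp
  next
    case False
    then obtain p where p: "prime p" "p dvd n" using prime_factor_nat by blast
    obtain a r where n: "n = p ^ a * r" "\<not> p dvd r"
      using less.prems(1) p(1) by (metis multiplicity_decompose' not_prime_unit not_gr_zero)
    have "a > 0" using n p(2) by (cases a) auto
    then obtain b where a: "a = Suc b" by (cases a) auto
    have p2: "p \<ge> 2" using p(1) by (simp add: prime_ge_2_nat)
    have pb: "p ^ b \<ge> 1" using p2 by (simp add: Suc_leI)
    have r0: "r > 0" using n less.prems(1) by (cases r) auto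
    have pa: "p ^ a \<ge> 2" using a pb p2 mult_le_mono[OF p2 pb] by simp
    have rn: "r < n" using n(1) pa r0 by simp
    \<comment> \<open>For \<open>N dvd r\<close>, the divisors of \<open>p ^ a * N\<close> that do
      not divide \<open>p ^ b * N\<close> are exactly the \<open>p ^ a * e\<close> with
      \<open>e dvd N\<close>. So each divisor sum of \<open>G\<close> is a difference of two divisor
      sums of \<open>g\<close>, which doubles the bound.\<close>
    define G where "G = (\<lambda>e. g (p ^ a * e))"
    have "norm (G r) \<le> real r * (2 * K)"
    proof (rule less.IH[OF rn r0])
      fix N assume N: "N dvd r"
      have N0: "N > 0" using N r0 by (cases N) auto
      have pN: "\<not> p dvd N" using N n(2) dvd_trans by blast
      define A where "A = {d. d dvd p ^ b * N}"
      define C where "C = (\<lambda>e. p ^ a * e) ` {e. e dvd N}"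
      have fin: "finite A" "finite C"
        using N0 p2 by (auto simp: A_def C_def intro!: finite_divisors_nat)
      have disj: "A \<inter> C = {}"
      proof (rule ccontr)
        assume "A \<inter> C \<noteq> {}"
        then obtain e where "p ^ a * e dvd p ^ b * N" by (auto simp: A_def C_def)
        then have "p ^ b * (p * e) dvd p ^ b * N" by (simp add: a mult_ac)
        then have "p * e dvd N" using p2 by (simp add: dvd_times_left_cancel_iff)
        then show False using pN dvd_mult_left by blast
      qed
      have un: "A \<union> C = {d. d dvd p ^ a * N}"
      proof (intro equalityI subsetI)
        fix d assume "d \<in> A \<union> C"
        then show "d \<in> {d. d dvd p ^ a * N}"
          by (auto simp: A_def C_def a intro: dvd_trans mult_dvd_mono)
      next
        fix d assume "d \<in> {d. d dvd p ^ a * N}"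
        then have d: "d dvd p ^ a * N" by simp
        then obtain u v where uv: "d = u * v" "u dvd p ^ a" "v dvd N"
          using division_decomp by blast
        then obtain i where i: "i \<le> a" "u = p ^ i"
          using p(1) divides_primepow_nat by blast
        show "d \<in> A \<union> C"
        proof (cases "i = a")
          case True
          then show ?thesis using uv i by (auto simp: C_def)
        next
          case False
          then have "p ^ i dvd p ^ b" using i a by (intro le_imp_power_dvd) simp
          then show ?thesis using uv i by (auto simp: A_def intro: mult_dvd_mono)
        qed
      qed
      have "p ^ b dvd p ^ a" by (rule le_imp_power_dvd) (simp add: a)
      then have dvd: "p ^ a * N dvd n" "p ^ b * N dvd n"
        using N mult_dvd_mono by (simp_all only: n(1) mult_dvd_mono dvd_refl)
      have inj: "inj_on (\<lambda>e. p ^ a * e) {e. e dvd N}"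
        using p2 by (auto simp: inj_on_def)
      have "(\<Sum>d | d dvd p ^ a * N. g d) = sum g A + sum g C"
        unfolding un[symmetric] by (rule sum.union_disjoint[OF fin disj])
      moreover have "sum g C = (\<Sum>e | e dvd N. G e)"
        unfolding C_def G_def by (subst sum.reindex[OF inj]) simp
      ultimately have "(\<Sum>e | e dvd N. G e) =
          (\<Sum>d | d dvd p ^ a * N. g d) - (\<Sum>d | d dvd p ^ b * N. g d)"
        by (simp add: A_def)
      also have "norm \<dots> \<le> K + K"
        by (intro order.trans[OF norm_triangle_ineq4] add_mono less.prems(2) dvd)
      finally show "norm (\<Sum>e | e dvd N. G e) \<le> 2 * K" by simp
    qed
    also have "\<dots> = real (2 * r) * K" by simp
    \<comment> \<open>The factor 2 is absorbed by \<open>p ^ a \<ge> 2\<close>, since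
      \<open>n = p ^ a * r\<close>.\<close>
    also have "\<dots> \<le> real n * K"
      by (intro mult_right_mono K of_nat_mono) (unfold n(1), intro mult_le_mono1 pa)
    finally show ?thesis by (simp add: G_def n(1))
  qed
qed

section \<open>Logarithmic derivative of the product as a Lambert series\<close>

text \<open>Multiplying the claimed series by \<open>1 - fps_X ^ n\<close>, which is a unit, leaves
  the single monomial of the numerator, because its coefficients are periodic with period
  \<open>n\<close>.\<close>

lemma has_fps_expansion_lambert_term:
  assumes "n > 0"
  shows "(\<lambda>z::complex. of_nat n * z ^ (n - 1) / (1 - z ^ n)) has_fps_expansion
           Abs_fps (\<lambda>j. if n dvd Suc j then of_nat n else 0)"
proof -
  define G :: "complex fps" where "G = Abs_fps (\<lambda>j. if n dvd Suc j then of_nat n else 0)"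
  have G0: "fps_nth (1 - fps_X ^ n :: complex fps) 0 \<noteq> 0"
    using assms by (simp add: fps_X_power_nth)
  have "G * (1 - fps_X ^ n) = fps_const (of_nat n) * fps_X ^ (n - 1)"
  proof (rule fps_ext)
    fix j
    \<comment> \<open>Below degree \<open>n\<close> no shifted coefficient is subtracted, and the
      only multiple of \<open>n\<close> among \<open>1..n\<close> is \<open>n\<close> itself; from
      degree \<open>n\<close> on, periodicity cancels everything.\<close>
    have "n dvd Suc j \<longleftrightarrow> j = n - 1" if "j < n"
      using that assms by (auto dest: dvd_imp_le)
    moreover have "n dvd Suc j \<longleftrightarrow> n dvd Suc (j - n)" if "j \<ge> n"
      using that by (metis Suc_diff_le dvd_minus_self le_imp_less_Suc not_less_iff_gr_or_eq)
    ultimately show "fps_nth (G * (1 - fps_X ^ n)) j =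
        fps_nth (fps_const (of_nat n) * fps_X ^ (n - 1)) j"
      using assms by (auto simp: G_def right_diff_distrib fps_X_power_mult_right_nth not_less)
  qed
  then have "G * ((1 - fps_X ^ n) * inverse (1 - fps_X ^ n)) =
      fps_const (of_nat n) * fps_X ^ (n - 1) * inverse (1 - fps_X ^ n)"
    by (simp only: mult.assoc[symmetric])
  then have eq: "fps_const (of_nat n) * fps_X ^ (n - 1) * inverse (1 - fps_X ^ n) = G"
    using inverse_mult_eq_1'[OF G0] by simp
  have "(\<lambda>z::complex. of_nat n * z ^ (n - 1) * inverse (1 - z ^ n)) has_fps_expansion
      fps_const (of_nat n) * fps_X ^ (n - 1) * inverse (1 - fps_X ^ n)"
    by (intro fps_expansion_intros G0)
  then show ?thesis unfolding eq by (simp add: G_def divide_inverse)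
qed

definition euler_partial :: "(nat \<Rightarrow> complex) \<Rightarrow> nat \<Rightarrow> complex \<Rightarrow> complex" where
  "euler_partial \<alpha> L z = (\<Prod>n = 2..L. (1 - z ^ n) powr \<alpha> n)"

text \<open>The logarithmic derivative of \<open>euler_partial\<close>.\<close>

definition lambert_partial :: "(nat \<Rightarrow> complex) \<Rightarrow> nat \<Rightarrow> complex \<Rightarrow> complex" where
  "lambert_partial \<alpha> L z = (\<Sum>n = 2..L. - \<alpha> n * (of_nat n * z ^ (n - 1) / (1 - z ^ n)))"

text \<open>Keeps the factors off the branch cut, so that their principal powers are differentiable
  on the whole unit disk.\<close>

lemma one_minus_power_notin_nonpos:
  fixes z :: complex
  assumes "norm z < 1" "n > 0"
  shows "1 - z ^ n \<notin> \<real>\<^sub>\<le>\<^sub>0"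
proof -
  have "norm (z ^ n) < 1" using assms by (simp add: norm_power power_less_one_iff)
  then have "Re (z ^ n) < 1" using abs_Re_le_cmod[of "z ^ n"] by linarith
  then show ?thesis by (auto simp: complex_nonpos_Reals_iff)
qed

lemma has_field_derivative_euler_partial:
  assumes "norm z < 1"
  shows "(euler_partial \<alpha> L has_field_derivative euler_partial \<alpha> L z * lambert_partial \<alpha> L z) (at z)"
proof (induction L)
  case 0
  then show ?case by (simp add: euler_partial_def[abs_def] lambert_partial_def)
next
  case (Suc L)
  show ?case
  proof (cases "Suc L \<ge> 2")
    case False
    then show ?thesis by (simp add: euler_partial_def[abs_def] lambert_partial_def)
  next
    case True
    have nz: "1 - z ^ Suc L \<notin> \<real>\<^sub>\<le>\<^sub>0"
      using one_minus_power_notin_nonpos[OF assms, of "Suc L"] by simp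
    then have nz0: "1 - z ^ Suc L \<noteq> 0" by auto
    have e: "euler_partial \<alpha> (Suc L) = (\<lambda>z. euler_partial \<alpha> L z * (1 - z ^ Suc L) powr \<alpha> (Suc L))"
      using True by (simp add: euler_partial_def fun_eq_iff)
    have l: "lambert_partial \<alpha> (Suc L) z = lambert_partial \<alpha> L z
        - \<alpha> (Suc L) * (of_nat (Suc L) * z ^ L / (1 - z ^ Suc L))"
      using True by (simp add: lambert_partial_def)
    have "((\<lambda>z. 1 - z ^ Suc L) has_field_derivative - (of_nat (Suc L) * z ^ L)) (at z)"
      using DERIV_diff[OF DERIV_const[of 1] DERIV_power[OF DERIV_ident, where n = "Suc L" and x = z]]
      by (simp del: power_Suc of_nat_Suc)
    then have "((\<lambda>z. (1 - z ^ Suc L) powr \<alpha> (Suc L)) has_field_derivative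
        (\<alpha> (Suc L) * (1 - z ^ Suc L) powr (\<alpha> (Suc L) - 1)) * - (of_nat (Suc L) * z ^ L)) (at z)"
      by (rule DERIV_chain2[where f = "\<lambda>w. w powr \<alpha> (Suc L)" and g = "\<lambda>z. 1 - z ^ Suc L",
          OF has_field_derivative_powr[OF nz]])
    then have "((\<lambda>z. (1 - z ^ Suc L) powr \<alpha> (Suc L)) has_field_derivative
        - (\<alpha> (Suc L) * (of_nat (Suc L) * z ^ L / (1 - z ^ Suc L))) * (1 - z ^ Suc L) powr \<alpha> (Suc L)) (at z)"
      by (rule DERIV_cong) (use nz0 in \<open>simp add: powr_diff del: power_Suc of_nat_Suc\<close>)
    from DERIV_mult[OF Suc.IH this] show ?thesis
      unfolding e l by (rule DERIV_cong) (simp add: algebra_simps del: power_Suc of_nat_Suc)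
  qed
qed

lemma holomorphic_euler_partial: "euler_partial \<alpha> L holomorphic_on ball 0 1"
  unfolding holomorphic_on_open[OF open_ball]
  by (meson has_field_derivative_euler_partial mem_ball_0)

lemma has_fps_expansion_lambert_partial:
  "lambert_partial \<alpha> L has_fps_expansion
     (\<Sum>n = 2..L. fps_const (- \<alpha> n) * Abs_fps (\<lambda>j. if n dvd Suc j then of_nat n else 0))"
  unfolding lambert_partial_def[abs_def]
  by (intro fps_expansion_intros has_fps_expansion_lambert_term) auto

text \<open>
  The identity \<open>P' = P Q\<close> for partial products is passed to the limit coefficientwise: the
  \<open>j\<close>-th coefficient of \<open>Q\<close> stabilises once \<open>L > j\<close>, so no convergence of the
  logarithmic derivatives themselves is required.
\<close>

lemma log_derivative_coefficients:
  assumes R: "0 < R" "R \<le> 1" and f: "f holomorphic_on ball 0 R" "f 0 \<noteq> 0"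
    and conv: "product_converges_compactly \<alpha> R f"
  shows "(\<lambda>z. deriv f z / f z) has_fps_expansion
           Abs_fps (\<lambda>j. - (\<Sum>d | d dvd Suc j. if d \<ge> 2 then of_nat d * \<alpha> d else 0))"
    (is "_ has_fps_expansion ?Q")
proof -
  define F where "F = fps_expansion f 0"
  define P where "P = (\<lambda>L. fps_expansion (euler_partial \<alpha> L) 0)"
  define Q where "Q = (\<lambda>L. \<Sum>n = 2..L. fps_const (- \<alpha> n) *
    Abs_fps (\<lambda>j. if n dvd Suc j then of_nat n else 0 :: complex))"
  have fF: "f has_fps_expansion F"
    unfolding F_def using f(1) R
    by (intro analytic_at_imp_has_fps_expansion_0) (auto simp: analytic_at intro!: exI[of _ "ball 0 R"])
  have PP: "euler_partial \<alpha> L has_fps_expansion P L" for L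
    unfolding P_def using holomorphic_euler_partial
    by (intro analytic_at_imp_has_fps_expansion_0) (auto simp: analytic_at intro!: exI[of _ "ball 0 1"])
  have PQ: "fps_deriv (P L) = P L * Q L" for L
  proof -
    \<comment> \<open>The derivative formula is available only in the unit disk; agreement near 0 is
      enough to identify the expansions.\<close>
    have "eventually (\<lambda>z. z \<in> ball (0::complex) 1) (nhds 0)"
      by (intro eventually_nhds_in_open) auto
    then have "eventually (\<lambda>z. deriv (euler_partial \<alpha> L) z =
        euler_partial \<alpha> L z * lambert_partial \<alpha> L z) (nhds 0)"
      by eventually_elim (auto intro!: DERIV_imp_deriv has_field_derivative_euler_partial)
    then have "deriv (euler_partial \<alpha> L) has_fps_expansion P L * Q L"
      using has_fps_expansion_mult[OF PP has_fps_expansion_lambert_partial, of L \<alpha> L]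
      by (simp only: has_fps_expansion_cong[OF _ refl] Q_def)
    with has_fps_expansion_deriv[OF PP] show ?thesis
      using fps_expansion_unique_complex by blast
  qed
  have PF: "(\<lambda>L. fps_nth (P L) j) \<longlonglongrightarrow> fps_nth F j" for j
  proof -
    \<comment> \<open>Any disk about 0 of radius below \<open>R\<close> would do. Uniform
      convergence of holomorphic functions on its interior carries over to all derivatives at 0,
      hence to the Taylor coefficients.\<close>
    have "uniform_limit (cball 0 (R / 2)) (\<lambda>L. euler_partial \<alpha> L) f sequentially"
      using conv[unfolded product_converges_compactly_def, rule_format, of "cball 0 (R / 2)"] R
      by (simp add: euler_partial_def[abs_def] cball_subset_ball_iff)
    then have "uniform_limit (ball 0 (R / 2)) (\<lambda>L. euler_partial \<alpha> L) f sequentially"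
      by (rule uniform_limit_on_subset) auto
    moreover have "euler_partial \<alpha> L holomorphic_on ball 0 (R / 2)" for L
      using R by (intro holomorphic_on_subset[OF holomorphic_euler_partial] subset_ball) simp
    ultimately have "(\<lambda>L. (deriv ^^ j) (euler_partial \<alpha> L) 0) \<longlonglongrightarrow> (deriv ^^ j) f 0"
      by (intro higher_deriv_complex_uniform_limit[where A = "ball 0 (R / 2)"] always_eventually)
        (use R in simp_all)
    then show ?thesis
      unfolding P_def F_def fps_expansion_def fps_nth_Abs_fps
      by (rule tendsto_divide[OF _ tendsto_const]) simp
  qed
  have QQ: "eventually (\<lambda>L. fps_nth (Q L) j = fps_nth ?Q j) sequentially" for j
    \<comment> \<open>From \<open>L = Suc j\<close> on, the range \<open>2..L\<close> contains all
      divisors of \<open>Suc j\<close> that are at least 2.\<close>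
    using eventually_ge_at_top[of "Suc j"]
  proof eventually_elim
    case (elim L)
    have "fps_nth (Q L) j = - (\<Sum>n = 2..L. if n dvd Suc j then of_nat n * \<alpha> n else 0)"
      unfolding Q_def fps_sum_nth sum_negf[symmetric] by (intro sum.cong) auto
    also have "(\<Sum>n = 2..L. if n dvd Suc j then of_nat n * \<alpha> n else 0) =
        (\<Sum>d | d dvd Suc j. if d \<ge> 2 then of_nat d * \<alpha> d else 0)"
      using elim by (intro sum.mono_neutral_cong) (auto dest: dvd_imp_le)
    finally show ?case by simp
  qed
  have eq: "fps_deriv F = F * ?Q"
  proof (rule fps_ext)
    fix j
    have "(\<lambda>L. fps_nth (Q L) i) \<longlonglongrightarrow> fps_nth ?Q i" for i
      by (rule tendsto_eventually[OF QQ])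
    then have "(\<lambda>L. fps_nth (P L * Q L) j) \<longlonglongrightarrow> fps_nth (F * ?Q) j"
      unfolding fps_mult_nth by (intro tendsto_sum tendsto_mult PF)
    moreover have "(\<lambda>L. fps_nth (fps_deriv (P L)) j) \<longlonglongrightarrow> fps_nth (fps_deriv F) j"
      unfolding fps_deriv_nth by (intro tendsto_mult tendsto_const PF)
    ultimately show "fps_nth (fps_deriv F) j = fps_nth (F * ?Q) j"
      unfolding PQ by (rule LIMSEQ_unique[rotated])
  qed
  have F0: "fps_nth F 0 \<noteq> 0" using f(2) by (simp add: F_def fps_expansion_def)
  have "fps_deriv F * inverse F = ?Q * (F * inverse F)"
    unfolding eq by (simp only: mult_ac)
  also have "\<dots> = ?Q" using inverse_mult_eq_1'[OF F0] by simp
  finally have "fps_deriv F * inverse F = ?Q" .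
  moreover have "(\<lambda>z. deriv f z * inverse (f z)) has_fps_expansion fps_deriv F * inverse F"
    by (intro fps_expansion_intros fF F0)
  ultimately show ?thesis by (simp add: divide_inverse)
qed

section \<open>Growth of the exponents\<close>

lemma norm_exponent_le:
  assumes R: "0 < R" "R \<le> 1" and f: "f analytic_on cball 0 R"
    and nz: "\<And>z. z \<in> cball 0 R \<Longrightarrow> f z \<noteq> 0"
    and conv: "product_converges_compactly \<alpha> R f"
    and B: "\<And>z. norm z = R \<Longrightarrow> norm (deriv f z / f z) \<le> B"
    and n: "n \<ge> 2"
  shows "norm (\<alpha> n) \<le> B / R ^ (n - 1)"
proof -
  \<comment> \<open>The product starts at \<open>n = 2\<close>, so the divisor 1 must contribute 0
    whatever the value of \<open>\<alpha> 1\<close>.\<close>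
  define g where "g = (\<lambda>d. if d \<ge> 2 then of_nat d * \<alpha> d else 0)"
  have hol: "(\<lambda>z. deriv f z / f z) analytic_on cball 0 R"
    by (intro analytic_intros f analytic_deriv nz) auto
  have B0: "B \<ge> 0"
    by (rule order_trans[OF norm_ge_zero B[of "of_real R"]]) (use R in simp)
  have fh: "f holomorphic_on ball 0 R"
    by (rule analytic_imp_holomorphic[OF analytic_on_subset[OF f ball_subset_cball]])
  have "f 0 \<noteq> 0" using nz[of 0] R by simp
  from log_derivative_coefficients[OF R fh this conv]
  have exp: "(\<lambda>z. deriv f z / f z) has_fps_expansion Abs_fps (\<lambda>j. - (\<Sum>d | d dvd Suc j. g d))"
    by (simp add: g_def)
  have "norm (g n) \<le> real n * (B / R ^ (n - 1))"
  proof (rule norm_le_of_divisor_sums)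
    fix N assume N: "N dvd n"
    then have N0: "N > 0" "N \<le> n" using n by (auto simp: dvd_imp_le intro: dvd_pos_nat[of n N])
    have "norm ((deriv ^^ (N - 1)) (\<lambda>z. deriv f z / f z) 0) \<le> fact (N - 1) * B / R ^ (N - 1)"
    proof (rule Cauchy_inequality)
      show "(\<lambda>z. deriv f z / f z) holomorphic_on ball 0 R"
        by (rule analytic_imp_holomorphic[OF analytic_on_subset[OF hol ball_subset_cball]])
      show "continuous_on (cball 0 R) (\<lambda>z. deriv f z / f z)"
        by (rule holomorphic_on_imp_continuous_on[OF analytic_imp_holomorphic[OF hol]])
      show "norm (deriv f z / f z) \<le> B" if "norm (0 - z) = R" for z
        using that by (intro B) simp
    qed (rule R)
    moreover have "- (\<Sum>d | d dvd N. g d) = (deriv ^^ (N - 1)) (\<lambda>z. deriv f z / f z) 0 / fact (N - 1)"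
      using fps_nth_fps_expansion[OF exp, of "N - 1"] N0 by simp
    then have "norm (\<Sum>d | d dvd N. g d) = norm ((deriv ^^ (N - 1)) (\<lambda>z. deriv f z / f z) 0) / fact (N - 1)"
      by (metis norm_minus_cancel norm_divide norm_fact)
    ultimately have "norm (\<Sum>d | d dvd N. g d) \<le> fact (N - 1) * B / R ^ (N - 1) / fact (N - 1)"
      by (simp only: divide_right_mono fact_ge_zero)
    then have "norm (\<Sum>d | d dvd N. g d) \<le> B / R ^ (N - 1)" by simp
    \<comment> \<open>Since \<open>R \<le> 1\<close>, the Cauchy bound is weakest for
      \<open>N = n\<close>; this gives one constant valid for all divisors of
      \<open>n\<close>.\<close>
    also have "\<dots> \<le> B / R ^ (n - 1)"
      using R B0 N0 by (intro divide_left_mono power_decreasing) auto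
    finally show "norm (\<Sum>d | d dvd N. g d) \<le> B / R ^ (n - 1)" .
  qed (use n in auto)
  \<comment> \<open>The factor \<open>n\<close> lost in the inversion of the divisor sums cancels
    against the one in \<open>g n = n * \<alpha> n\<close>.\<close>
  then have "real n * norm (\<alpha> n) \<le> real n * (B / R ^ (n - 1))"
    using n by (simp add: g_def norm_mult)
  then show ?thesis by (rule mult_left_le_imp_le) (use n in simp)
qed

section \<open>Bounds for the logarithm of the partial zeta function\<close>

text \<open>Nonnegativity of \<open>h\<close> makes \<open>g\<close> decreasing from
  \<open>q 0\<close> on, so the integers skipped by \<open>q\<close> only enlarge the available
  telescoping difference. This is how sums over primes are bounded by sums over all
  integers.\<close>

lemma telescoping_bound_along_subsequence:
  fixes q :: "nat \<Rightarrow> nat" and g h :: "nat \<Rightarrow> real"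
  assumes q: "strict_mono q"
    and h: "\<And>j. j \<ge> q 0 \<Longrightarrow> 0 \<le> h j" "\<And>j. j \<ge> q 0 \<Longrightarrow> h j \<le> g j - g (Suc j)"
    and g: "\<And>j. j \<ge> q 0 \<Longrightarrow> 0 \<le> g j"
  shows "summable (\<lambda>k. h (q k))" "(\<Sum>k. h (q k)) \<le> g (q 0)"
proof -
  have ge: "q k \<ge> q 0" for k using q by (simp add: strict_mono_less_eq)
  have dec: "g j \<le> g i" if "q 0 \<le> i" "i \<le> j" for i j
    using that(2,1)
  proof (induction rule: dec_induct)
    case (step j)
    then show ?case using h[of j] by simp
  qed simp
  have part: "(\<Sum>k<K. h (q k)) \<le> g (q 0) - g (q K)" for K
  proof (induction K)
    case (Suc K)
    have "Suc (q K) \<le> q (Suc K)" using q by (simp add: Suc_leI strict_mono_less)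
    then have "g (q (Suc K)) \<le> g (Suc (q K))" using ge[of K] by (intro dec) auto
    then show ?case using Suc h(2)[OF ge[of K]] by simp
  qed simp
  have part': "(\<Sum>k<K. h (q k)) \<le> g (q 0)" for K using part[of K] g[OF ge[of K]] by simp
  show s: "summable (\<lambda>k. h (q k))"
    by (rule summableI_nonneg_bounded[OF _ part']) (use h ge in auto)
  show "(\<Sum>k. h (q k)) \<le> g (q 0)"
    by (rule suminf_le_const[OF s part'])
qed

text \<open>The upper bound is \<open>ln y \<le> y - 1\<close> at
  \<open>y = 1 / (1 - 1 / j ^ n)\<close>.\<close>

lemma neg_ln_one_minus_inverse_power:
  assumes "j \<ge> 2" "n \<ge> 1"
  shows "0 \<le> - ln (1 - 1 / real j ^ n)" "- ln (1 - 1 / real j ^ n) \<le> 1 / (real j ^ n - 1)"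
proof -
  have j: "real j ^ n > 1" using assms by (intro one_less_power) auto
  have frac: "1 / (1 - 1 / y) - 1 = 1 / (y - 1)" if "y > 1" for y :: real
    using that by (simp add: divide_simps)
  from j have pos: "1 - 1 / real j ^ n > 0" by (auto simp: divide_less_eq)
  show "0 \<le> - ln (1 - 1 / real j ^ n)" using pos j ln_le_zero_iff[OF pos] by simp
  have "- ln (1 - 1 / real j ^ n) = ln (1 / (1 - 1 / real j ^ n))"
    using pos by (simp add: ln_div)
  also have "\<dots> \<le> 1 / (1 - 1 / real j ^ n) - 1" using pos by (intro ln_le_minus_one) simp
  also have "\<dots> = 1 / (real j ^ n - 1)" by (rule frac[OF j])
  finally show "- ln (1 - 1 / real j ^ n) \<le> 1 / (real j ^ n - 1)" .
qed

text \<open>Here \<open>1 / (j * (j - 1))\<close> telescopes. The constant 2 cannot be lowered to 1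
  for arbitrary \<open>q\<close>: if \<open>q\<close> runs through all integers from 2 on, the sum
  is \<open>ln 2 > 1 / 2\<close>.\<close>

lemma log_zeta_sum_two:
  fixes q :: "nat \<Rightarrow> nat"
  assumes q: "strict_mono q" and q0: "q 0 \<ge> 2"
  shows "summable (\<lambda>k. - ln (1 - 1 / real (q k) ^ 2))"
    "(\<Sum>k. - ln (1 - 1 / real (q k) ^ 2)) \<le> 2 / real (q 0)"
proof -
  have step: "- ln (1 - 1 / real j ^ 2) \<le> 1 / (real j - 1) - 1 / (real (Suc j) - 1)" if "j \<ge> q 0" for j
  proof -
    have "- ln (1 - 1 / real j ^ 2) \<le> 1 / (real j ^ 2 - 1)"
      using that q0 by (intro neg_ln_one_minus_inverse_power) auto
    also have "\<dots> \<le> 1 / (real j * (real j - 1))"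
    proof -
      have "(0::real) < real j * (real j - 1)" "real j * (real j - 1) \<le> real j ^ 2 - 1"
        using that q0 by (auto simp: power2_eq_square algebra_simps)
      then show ?thesis by (intro divide_left_mono) auto
    qed
    also have "\<dots> = 1 / (real j - 1) - 1 / (real (Suc j) - 1)"
      using that q0 by (simp add: divide_simps)
    finally show ?thesis .
  qed
  note t = telescoping_bound_along_subsequence[OF q, of "\<lambda>j. - ln (1 - 1 / real j ^ 2)"
      "\<lambda>j. 1 / (real j - 1)", OF neg_ln_one_minus_inverse_power(1) step]
  show "summable (\<lambda>k. - ln (1 - 1 / real (q k) ^ 2))" by (rule t) (use q0 in auto)
  have "(\<Sum>k. - ln (1 - 1 / real (q k) ^ 2)) \<le> 1 / (real (q 0) - 1)" by (rule t) (use q0 in auto)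
  also have "\<dots> \<le> 2 / real (q 0)" using q0 by (simp add: divide_simps)
  finally show "(\<Sum>k. - ln (1 - 1 / real (q k) ^ 2)) \<le> 2 / real (q 0)" .
qed

text \<open>
  The bound comes from \<open>j\<^sup>n - 1 \<ge> p\<^bsup>n-3\<^esup> (j\<^sup>3 - j)\<close> for \<open>j \<ge> p\<close>, since
  \<open>1 / (j\<^sup>3 - j)\<close> telescopes.
\<close>

lemma log_zeta_sum_ge_3:
  fixes q :: "nat \<Rightarrow> nat"
  assumes q: "strict_mono q" and q0: "q 0 \<ge> 2" and n: "n \<ge> 3"
  shows "summable (\<lambda>k. - ln (1 - 1 / real (q k) ^ n))"
    "(\<Sum>k. - ln (1 - 1 / real (q k) ^ n)) \<le> 1 / real (q 0) ^ (n - 1)"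
proof -
  define p where "p = real (q 0)"
  define D where "D = p ^ (n - 3)"
  have p: "p \<ge> 2" using q0 by (simp add: p_def)
  then have D: "D > 0" by (simp add: D_def)
  have step: "- ln (1 - 1 / real j ^ n) \<le> 1 / (2 * D * (real j * (real j - 1))) -
      1 / (2 * D * (real (Suc j) * (real (Suc j) - 1)))" if "j \<ge> q 0" for j
  proof -
    define x where "x = real j"
    have x: "x \<ge> p" "x \<ge> 2" using that p by (auto simp: x_def p_def)
    have "x ^ n = x ^ (n - 3) * x ^ 3" using n by (simp flip: power_add)
    moreover have "D \<le> x ^ (n - 3)" unfolding D_def using x p by (intro power_mono) auto
    then have "D * (x ^ 3 - 1) \<le> x ^ (n - 3) * (x ^ 3 - 1)"
      using x by (intro mult_right_mono) auto
    moreover have "x ^ (n - 3) \<ge> 1" using x by (intro one_le_power) auto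
    ultimately have "D * (x ^ 3 - 1) \<le> x ^ n - 1" by (simp add: algebra_simps)
    moreover have "D * (x ^ 3 - x) \<le> D * (x ^ 3 - 1)" using D x by (intro mult_left_mono) auto
    ultimately have le: "D * (x ^ 3 - x) \<le> x ^ n - 1" by linarith
    have "x ^ 3 - x = x * (x - 1) * (x + 1)" by (simp add: algebra_simps power3_eq_cube)
    moreover have "\<dots> > 0" using x by auto
    ultimately have pos: "D * (x ^ 3 - x) > 0" using D by simp
    have "- ln (1 - 1 / real j ^ n) \<le> 1 / (x ^ n - 1)"
      unfolding x_def using that q0 n by (intro neg_ln_one_minus_inverse_power) auto
    also have "\<dots> \<le> 1 / (D * (x ^ 3 - x))" using le pos by (intro divide_left_mono) auto
    also have "\<dots> = 1 / (2 * D * (x * (x - 1))) - 1 / (2 * D * ((x + 1) * x))"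
      unfolding \<open>x ^ 3 - x = _\<close> using D x by (simp add: divide_simps)
    finally show ?thesis by (simp add: x_def algebra_simps)
  qed
  note t = telescoping_bound_along_subsequence[OF q, of "\<lambda>j. - ln (1 - 1 / real j ^ n)"
      "\<lambda>j. 1 / (2 * D * (real j * (real j - 1)))", OF neg_ln_one_minus_inverse_power(1) step]
  show "summable (\<lambda>k. - ln (1 - 1 / real (q k) ^ n))"
    by (rule t) (use q0 n D in auto)
  have "(\<Sum>k. - ln (1 - 1 / real (q k) ^ n)) \<le> 1 / (2 * D * (real (q 0) * (real (q 0) - 1)))"
    by (rule t) (use q0 n D in auto)
  \<comment> \<open>The 2 from the partial fractions is used up by
    \<open>2 * (p - 1) \<ge> p\<close>, so that the final constant is 1.\<close>
  also have "\<dots> \<le> 1 / (D * p ^ 2)"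
  proof -
    have "p * p \<le> p * (2 * (p - 1))" using p by (intro mult_left_mono) auto
    then have "D * p ^ 2 \<le> D * (2 * (p * (p - 1)))"
      using D by (intro mult_left_mono) (auto simp: power2_eq_square algebra_simps)
    then show ?thesis using D p by (intro divide_left_mono) (auto simp: p_def mult_ac)
  qed
  finally have "(\<Sum>k. - ln (1 - 1 / real (q k) ^ n)) \<le> 1 / (D * p ^ 2)" .
  moreover have "n - 3 + 2 = n - 1" using n by simp
  then have Dp: "D * p ^ 2 = p ^ (n - 1)" unfolding D_def power_add[symmetric] by simp
  ultimately show "(\<Sum>k. - ln (1 - 1 / real (q k) ^ n)) \<le> 1 / real (q 0) ^ (n - 1)"
    by (simp only: Dp p_def)
qed

text \<open>A cruder bound that includes \<open>n = 2\<close>. It serves convergence only; the error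
  term relies on the sharper bound for \<open>n \<ge> 3\<close>.\<close>

lemma log_zeta_sum:
  fixes q :: "nat \<Rightarrow> nat"
  assumes q: "strict_mono q" and q0: "q 0 \<ge> 2" and n: "n \<ge> 2"
  shows "summable (\<lambda>k. - ln (1 - 1 / real (q k) ^ n))"
    "(\<Sum>k. - ln (1 - 1 / real (q k) ^ n)) \<le> 2 / real (q 0) ^ (n - 1)"
proof -
  have "summable (\<lambda>k. - ln (1 - 1 / real (q k) ^ n)) \<and>
    (\<Sum>k. - ln (1 - 1 / real (q k) ^ n)) \<le> 2 / real (q 0) ^ (n - 1)"
  proof (cases "n = 2")
    case True
    then show ?thesis using log_zeta_sum_two[OF q q0] by simp
  next
    case False
    then have "n \<ge> 3" using n by simp
    note t = log_zeta_sum_ge_3[OF q q0 this]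
    have "1 / real (q 0) ^ (n - 1) \<le> 2 / real (q 0) ^ (n - 1)" by (intro divide_right_mono) auto
    with t show ?thesis by linarith
  qed
  then show "summable (\<lambda>k. - ln (1 - 1 / real (q k) ^ n))"
    "(\<Sum>k. - ln (1 - 1 / real (q k) ^ n)) \<le> 2 / real (q 0) ^ (n - 1)" by auto
qed

section \<open>The Euler product over the primes\<close>

text \<open>The condition on \<open>m\<close> excludes index 0, where truncated subtraction makes
  \<open>nth_prime 0\<close> equal to \<open>nth_prime 1\<close>.\<close>

lemma strict_mono_nth_prime:
  assumes "m \<ge> 1"
  shows "strict_mono (\<lambda>k. nth_prime (m + k))"
proof -
  have "strict_mono (enumerate {p::nat. prime p})"
    using primes_infinite by (rule strict_mono_enumerate)
  then show ?thesis using assms by (auto simp: nth_prime_def strict_mono_def)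
qed

lemma nth_prime_ge_2: "nth_prime k \<ge> 2"
  using enumerate_in_set[OF primes_infinite, of "k - 1"] by (simp add: nth_prime_def prime_ge_2_nat)

text \<open>Each Euler factor is the exponential of a term of a convergent series, so the infinite
  product is the exponential of its sum.\<close>

lemma ln_partial_zeta:
  assumes m: "m \<ge> 1" and n: "n \<ge> 2"
  shows "ln (partial_zeta m (real n)) = (\<Sum>k. - ln (1 - 1 / real (nth_prime (m + k)) ^ n))"
proof -
  let ?l = "\<lambda>k. - ln (1 - 1 / real (nth_prime (m + k)) ^ n)"
  have s: "summable ?l"
    using log_zeta_sum(1)[OF strict_mono_nth_prime[OF m] _ n] nth_prime_ge_2 by simp
  have "inverse (1 - real (nth_prime (m + k)) powr (- real n)) = exp (?l k)" for k
  proof -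
    have q: "real (nth_prime (m + k)) \<ge> 2" using nth_prime_ge_2[of "m + k"] by simp
    then have "real (nth_prime (m + k)) ^ n > 1" using n by (intro one_less_power) auto
    then have "1 - 1 / real (nth_prime (m + k)) ^ n > 0" by (auto simp: divide_less_eq)
    then show ?thesis using q by (simp add: exp_minus powr_minus powr_realpow divide_inverse)
  qed
  then have "partial_zeta m (real n) = exp (suminf ?l)"
    unfolding partial_zeta_def using prodinf_exp[OF s] by simp
  then show ?thesis by simp
qed

section \<open>An exponential estimate and the interchange of summations\<close>

text \<open>For \<open>norm w \<le> 1\<close> every power of \<open>w\<close> from the first on has
  norm at most \<open>norm w\<close>; the remaining reciprocal factorials sum to
  \<open>exp 1 - 1\<close>. This is the source of that constant in
  \<open>error_const\<close>.\<close>

lemma norm_exp_minus_one_le: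
  fixes w :: complex
  assumes "norm w \<le> 1"
  shows "norm (exp w - 1) \<le> (exp 1 - 1) * norm w"
proof -
  have t: "(\<lambda>n. w ^ Suc n /\<^sub>R fact (Suc n)) sums (exp w - 1)"
    using exp_converges[of w] by (subst sums_Suc_iff) simp
  have e: "(\<lambda>n. norm w * (1 ^ Suc n /\<^sub>R fact (Suc n))) sums (norm w * (exp 1 - 1))"
    using exp_converges[of "1::real"] by (intro sums_mult, subst sums_Suc_iff) simp
  have le: "norm (w ^ Suc n /\<^sub>R fact (Suc n)) \<le> norm w * (1 ^ Suc n /\<^sub>R fact (Suc n))" for n
  proof -
    have "norm w ^ n \<le> 1" using assms by (simp add: power_le_one)
    then have "norm w * norm w ^ n \<le> norm w" using mult_left_mono[of "norm w ^ n" 1 "norm w"] by simp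
    then show ?thesis by (simp add: norm_mult norm_power divide_simps del: fact_Suc)
  qed
  have "norm (suminf (\<lambda>n. w ^ Suc n /\<^sub>R fact (Suc n))) \<le> suminf (\<lambda>n. norm w * (1 ^ Suc n /\<^sub>R fact (Suc n)))"
    using le sums_summable[OF e] by (rule norm_suminf_le)
  then show ?thesis using sums_unique[OF t] sums_unique[OF e] by (simp add: mult.commute)
qed

text \<open>Fubini for double series, by way of unordered summability on the product of the index
  sets. The first conclusion gives convergence at a single prime, the second convergence of the
  product over the primes.\<close>

lemma absolutely_summable_suminf_swap:
  fixes a :: "nat \<Rightarrow> nat \<Rightarrow> 'a::banach"
  assumes row: "\<And>n. summable (\<lambda>k. norm (a n k))"
    and rows: "summable (\<lambda>n. \<Sum>k. norm (a n k))"
  shows "summable (\<lambda>n. norm (a n k))"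
    and "summable (\<lambda>k. \<Sum>n. a n k)"
    and "(\<Sum>k. \<Sum>n. a n k) = (\<Sum>n. \<Sum>k. a n k)"
proof -
  have inf: "infsum u UNIV = suminf u" if "u summable_on UNIV" for u :: "nat \<Rightarrow> 'b::banach"
    using has_sum_imp_sums[OF has_sum_infsum[OF that]] by (simp add: sums_iff)
  have inf': "infsum u UNIV = suminf u" if "u summable_on UNIV" for u :: "nat \<Rightarrow> real"
    using has_sum_imp_sums[OF has_sum_infsum[OF that]] by (simp add: sums_iff)
  have r: "(\<lambda>k. norm (a n k)) summable_on UNIV" for n
    using row by (simp add: summable_on_UNIV_nonneg_real_iff)
  have "(\<lambda>n. \<Sum>\<^sub>\<infinity>k. norm (a n k)) summable_on UNIV"
    using rows row by (simp add: inf'[OF r] summable_on_UNIV_nonneg_real_iff suminf_nonneg)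
  then have abs: "(\<lambda>x. norm (case x of (n, k) \<Rightarrow> a n k)) summable_on UNIV \<times> UNIV"
    using r Infinite_Sum.abs_summable_on_Sigma_iff[where f = "\<lambda>(n, k). a n k"
        and A = UNIV and B = "\<lambda>_. UNIV"]
    by (simp add: infsum_nonneg)
  then have "(\<lambda>x. norm (case x of (k, n) \<Rightarrow> a n k)) summable_on UNIV \<times> UNIV"
    using summable_on_swap[of "\<lambda>x. norm (case x of (n, k) \<Rightarrow> a n k)" UNIV UNIV]
    by (simp add: case_prod_unfold)
  then have abs': "(\<lambda>n. norm (a n k)) summable_on UNIV" for k
    using Infinite_Sum.abs_summable_on_Sigma_iff[where f = "\<lambda>(k, n). a n k"
        and A = UNIV and B = "\<lambda>_. UNIV"] by simp
  show "summable (\<lambda>n. norm (a n k))"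
    using abs' by (rule summable_on_imp_summable)
  have joint: "(\<lambda>(n, k). a n k) summable_on UNIV \<times> UNIV"
    using abs by (rule abs_summable_summable)
  have joint': "(\<lambda>(k, n). a n k) summable_on UNIV \<times> UNIV"
    using joint summable_on_swap[of "\<lambda>(n, k). a n k" UNIV UNIV] by (simp add: case_prod_unfold)
  have c: "(\<lambda>n. a n k) summable_on UNIV" for k
    using abs' by (rule abs_summable_summable)
  have c': "a n summable_on UNIV" for n
    using r[of n] by (rule abs_summable_summable)
  have cs: "(\<lambda>k. \<Sum>\<^sub>\<infinity>n. a n k) summable_on UNIV"
    using summable_on_Sigma_banach[OF joint'] by simp
  have cs': "(\<lambda>n. \<Sum>\<^sub>\<infinity>k. a n k) summable_on UNIV"
    using summable_on_Sigma_banach[OF joint] by simp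
  show "summable (\<lambda>k. \<Sum>n. a n k)"
    using summable_on_imp_summable[OF cs] by (simp add: inf[OF c])
  show "(\<Sum>k. \<Sum>n. a n k) = (\<Sum>n. \<Sum>k. a n k)"
    using infsum_swap_banach[OF joint] inf[OF cs] inf[OF cs'] by (simp add: inf[OF c] inf[OF c'])
qed

section \<open>The error estimate for the product over the primes\<close>

theorem theorem4p1:
  fixes R B :: real and f :: "complex \<Rightarrow> complex" and \<alpha> :: "nat \<Rightarrow> complex" and m M :: nat
  assumes "0 < R" and "R \<le> 1"
    and "f analytic_on cball 0 R"
    and "\<And>z. z \<in> cball 0 R \<Longrightarrow> f z \<noteq> 0"
    and "product_converges_compactly \<alpha> R f"
    and "\<And>z. norm z = R \<Longrightarrow> norm (deriv f z / f z) \<le> B"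
    and "1 \<le> m" and "R * real (nth_prime m) > 1"
    and "m < M" and "error_const R B m M \<le> 1"
  shows "convergent_prod (\<lambda>k. f (1 / of_nat (nth_prime (m + k)))) \<and>
         norm ((\<Prod>k. f (1 / of_nat (nth_prime (m + k)))) - zeta_prod \<alpha> m M)
           \<le> error_const R B m M * norm (zeta_prod \<alpha> m M)"
proof -
  note R = assms(1,2)
  define q where "q = (\<lambda>k. nth_prime (m + k))"
  define p where "p = real (nth_prime m)"
  \<comment> \<open>The ratio of the geometric series that dominates the tail.\<close>
  define x where "x = 1 / (R * p)"
  \<comment> \<open>Extending the exponents by 0 lets all series run over every natural number and
    discards the arbitrary values \<open>\<alpha> 0\<close> and \<open>\<alpha> 1\<close>.\<close>
  define \<beta> where "\<beta> = (\<lambda>n. if n \<ge> 2 then \<alpha> n else 0)"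
  define l where "l = (\<lambda>n k. ln (1 - 1 / real (q k) ^ n))"
  define S where "S = (\<lambda>n. \<Sum>k. - l n k)"
  define a where "a = (\<lambda>n k. \<beta> n * of_real (l n k))"
  have q: "strict_mono q" "q 0 \<ge> 2" "real (q 0) = p" "q k \<ge> 2" for k
    using strict_mono_nth_prime[OF assms(7)] nth_prime_ge_2 by (simp_all add: q_def p_def)
  have p: "p \<ge> 2" "R * p > 1" using nth_prime_ge_2 assms(8) by (simp_all add: p_def)
  have x: "0 < x" "x < 1" using p R by (auto simp: x_def)
  have B0: "B \<ge> 0"
    using assms(6)[of "of_real R"] R norm_ge_zero by (smt (verit) norm_of_real)
  have \<beta>: "norm (\<beta> n) \<le> B / R ^ (n - 1)" for n
    using norm_exponent_le[OF assms(1-6)] B0 R by (auto simp: \<beta>_def)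
  have l0: "l n k \<le> 0" if "n \<ge> 2" for n k
    using neg_ln_one_minus_inverse_power(1)[of "q k" n] q that by (simp add: l_def)
  have l: "summable (\<lambda>k. - l n k)" "S n \<le> 2 / p ^ (n - 1)" if "n \<ge> 2" for n
    using log_zeta_sum[OF q(1,2) that] by (auto simp: l_def S_def q(3))
  have l3: "S n \<le> 1 / p ^ (n - 1)" if "n \<ge> 3" for n
    using log_zeta_sum_ge_3[OF q(1,2) that] by (auto simp: l_def S_def q(3))
  have S0: "0 \<le> S n" if "n \<ge> 2" for n
    unfolding S_def using l[OF that] l0[OF that] by (intro suminf_nonneg) auto
  have xpow: "B / R ^ i * (c / p ^ i) = c * B * x ^ i" for i c
    by (simp add: x_def power_divide power_mult_distrib)
  have row: "(\<lambda>k. norm (a n k)) sums (norm (\<beta> n) * S n)" for n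
  proof (cases "n \<ge> 2")
    case True
    have "norm (a n k) = norm (\<beta> n) * - l n k" for k
      using l0[OF True, of k] by (simp add: a_def norm_mult)
    then show ?thesis using l(1)[OF True] by (simp only: S_def) (intro sums_mult summable_sums)
  qed (simp add: a_def \<beta>_def)
  have \<beta>S: "norm (\<beta> n) * S n \<le> 2 * B * x ^ (n - 1)" for n
  proof (cases "n \<ge> 2")
    case True
    have "norm (\<beta> n) * S n \<le> B / R ^ (n - 1) * (2 / p ^ (n - 1))"
      using \<beta> l(2)[OF True] S0[OF True] B0 R by (intro mult_mono) auto
    then show ?thesis unfolding xpow by simp
  qed (use B0 x in \<open>simp add: \<beta>_def\<close>)
  have \<beta>S3: "norm (\<beta> n) * S n \<le> B * x ^ (n - 1)" if "n \<ge> 3" for n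
  proof -
    have "norm (\<beta> n) * S n \<le> B / R ^ (n - 1) * (1 / p ^ (n - 1))"
      using \<beta> l3[OF that] S0[of n] that B0 R by (intro mult_mono) auto
    then show ?thesis unfolding xpow by simp
  qed
  have \<beta>S0: "norm (\<beta> n) * S n \<ge> 0" for n
    using S0[of n] by (cases "n \<ge> 2") (auto simp: \<beta>_def)
  have geo: "summable (\<lambda>i. x ^ i)" using x by (simp add: summable_geometric)
  \<comment> \<open>The index is shifted by one because the bounds carry the exponent
    \<open>n - 1\<close>.\<close>
  have rows: "summable (\<lambda>n. norm (\<beta> n) * S n)"
  proof (subst summable_Suc_iff[symmetric], rule summable_comparison_test')
    show "summable (\<lambda>n. 2 * B * x ^ n)" by (intro summable_mult geo)
    show "norm (norm (\<beta> (Suc n)) * S (Suc n)) \<le> 2 * B * x ^ n" for n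
      using \<beta>S[of "Suc n"] \<beta>S0[of "Suc n"] by simp
  qed
  have "(\<lambda>n. \<Sum>k. norm (a n k)) = (\<lambda>n. norm (\<beta> n) * S n)"
    using sums_unique[OF row] by simp
  with rows have "summable (\<lambda>n. \<Sum>k. norm (a n k))" by simp
  note swap = absolutely_summable_suminf_swap[OF sums_summable[OF row] this]
  have inner: "(\<Sum>k. a n k) = - \<beta> n * of_real (S n)" for n
  proof (cases "n \<ge> 2")
    case True
    have "(\<lambda>k. - \<beta> n * of_real (- l n k)) sums (- \<beta> n * of_real (S n))"
      unfolding S_def using l(1)[OF True] by (intro sums_mult sums_of_real summable_sums)
    then show ?thesis by (simp add: a_def sums_iff)
  qed (simp add: a_def \<beta>_def)
  have f_eq: "f (1 / of_nat (q k)) = exp (\<Sum>n. a n k)" for k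
  proof -
    define z :: complex where "z = 1 / of_nat (q k)"
    have "q k \<ge> q 0" using q(1) by (simp add: strict_mono_less_eq)
    then have "R * p \<le> R * real (q k)" using q(3) R by (intro mult_left_mono) auto
    then have "1 < R * real (q k)" using p by simp
    then have "norm z < R" using R q(4)[of k] by (auto simp: z_def norm_divide divide_less_eq)
    \<comment> \<open>Pointwise convergence at \<open>z\<close> is compact convergence on the
      singleton \<open>{z}\<close>, which lies in the disk because
      \<open>R * q k \<ge> R * p > 1\<close>.\<close>
    then have "(\<lambda>L. euler_partial \<alpha> L z) \<longlonglongrightarrow> f z"
      using assms(5)[unfolded product_converges_compactly_def, rule_format, of "{z}"]
      by (intro tendsto_uniform_limitI[where x = z and S = "{z}"]) (simp_all add: euler_partial_def)
    moreover have "euler_partial \<alpha> L z = exp (\<Sum>n\<le>L. a n k)" for L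
    proof -
      have "(1 - z ^ n) powr \<alpha> n = exp (a n k)" if "n \<ge> 2" for n
      proof -
        have "real (q k) ^ n > 1" using q(4)[of k] that by (intro one_less_power) auto
        then have pos: "1 - 1 / real (q k) ^ n > 0" by (auto simp: divide_less_eq)
        have "1 - z ^ n = of_real (1 - 1 / real (q k) ^ n)" by (simp add: z_def power_divide)
        also have "\<dots> powr \<alpha> n = exp (\<alpha> n * of_real (ln (1 - 1 / real (q k) ^ n)))"
          unfolding powr_def Ln_of_real[OF pos] of_real_eq_0_iff by (rule if_not_P) (use pos in linarith)
        finally show ?thesis using that by (simp only: a_def \<beta>_def l_def if_True)
      qed
      then have "euler_partial \<alpha> L z = exp (\<Sum>n = 2..L. a n k)"
        by (simp add: euler_partial_def exp_sum)
      also have "(\<Sum>n = 2..L. a n k) = (\<Sum>n\<le>L. a n k)"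
        by (intro sum.mono_neutral_left) (auto simp: a_def \<beta>_def)
      finally show ?thesis .
    qed
    moreover have "(\<lambda>L. exp (\<Sum>n\<le>L. a n k)) \<longlonglongrightarrow> exp (\<Sum>n. a n k)"
      by (intro tendsto_exp summable_LIMSEQ' summable_norm_cancel[OF swap(1)])
    ultimately have "f z = exp (\<Sum>n. a n k)" by (simp only: LIMSEQ_unique)
    then show ?thesis by (simp only: z_def)
  qed
  have conv: "convergent_prod (\<lambda>k. f (1 / of_nat (q k)))"
    unfolding f_eq by (rule convergent_prod_exp[OF swap(2)])
  have prod: "(\<Prod>k. f (1 / of_nat (q k))) = exp (\<Sum>n. - \<beta> n * of_real (S n))"
    unfolding f_eq prodinf_exp[OF swap(2)] swap(3) inner ..
  \<comment> \<open>\<open>W\<close> is a logarithm of the ratio between the full product and its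
    truncation \<open>zeta_prod \<alpha> m M\<close>.\<close>
  define W where "W = (\<Sum>n. - \<beta> (n + Suc M) * of_real (S (n + Suc M)))"
  have norm_eq: "norm (- \<beta> n * of_real (S n)) = norm (\<beta> n) * S n" for n
    using S0[of n] by (cases "n \<ge> 2") (auto simp: \<beta>_def norm_mult)
  have "summable (\<lambda>n. - \<beta> n * of_real (S n))"
    by (rule summable_norm_cancel) (simp only: norm_eq rows)
  from suminf_split_initial_segment[OF this, of "Suc M"]
  have "(\<Sum>n. - \<beta> n * of_real (S n)) = W + (\<Sum>n<Suc M. - \<beta> n * of_real (S n))"
    by (simp only: W_def)
  also have "(\<Sum>n<Suc M. - \<beta> n * of_real (S n)) = (\<Sum>n = 2..M. - \<alpha> n * of_real (S n))"
    by (intro sum.mono_neutral_cong_right) (auto simp: \<beta>_def)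
  finally have "exp (\<Sum>n. - \<beta> n * of_real (S n)) = exp W * exp (\<Sum>n = 2..M. - \<alpha> n * of_real (S n))"
    by (simp only: exp_add)
  also have "exp (\<Sum>n = 2..M. - \<alpha> n * of_real (S n)) = zeta_prod \<alpha> m M"
    unfolding zeta_prod_def exp_sum[OF finite_atLeastAtMost]
    by (intro prod.cong refl) (simp only: ln_partial_zeta[OF assms(7)] atLeastAtMost_iff S_def l_def q_def)
  finally have split: "exp (\<Sum>n. - \<beta> n * of_real (S n)) = exp W * zeta_prod \<alpha> m M" .
  have "norm W \<le> (\<Sum>n. B * x ^ M * x ^ n)"
    unfolding W_def
  proof (rule norm_suminf_le)
    show "summable (\<lambda>n. B * x ^ M * x ^ n)" by (intro summable_mult geo)
    show "norm (- \<beta> (n + Suc M) * of_real (S (n + Suc M))) \<le> B * x ^ M * x ^ n" for n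
      \<comment> \<open>From \<open>1 \<le> m < M\<close> the tail starts at an index of at least 3,
        so the bound with constant 1 applies to each of its terms.\<close>
      unfolding norm_eq using \<beta>S3[of "n + Suc M"] assms(7,9) by (simp add: power_add mult_ac)
  qed
  also have "\<dots> = B * x ^ M * (1 / (1 - x))"
    using x by (simp add: suminf_mult[OF geo] suminf_geometric)
  also have "1 / (1 - x) = R * p / (R * p - 1)"
    using p R by (simp add: x_def divide_simps)
  \<comment> \<open>The numerator \<open>R * p\<close> is relaxed to \<open>p\<close> by
    \<open>R \<le> 1\<close>, which gives the form in \<open>error_const\<close>.\<close>
  also have "B * x ^ M * (R * p / (R * p - 1)) \<le> B * x ^ M * (p / (R * p - 1))"
    using B0 x p R by (intro mult_left_mono divide_right_mono) auto
  finally have W: "norm W \<le> B * x ^ M * (p / (R * p - 1))" .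
  have err: "error_const R B m M = (exp 1 - 1) * (B * x ^ M * (p / (R * p - 1)))"
    by (simp add: error_const_def x_def p_def power_divide mult_ac)
  have e1: "exp 1 - (1::real) \<ge> 1" using exp_ge_add_one_self[of "1::real"] by simp
  have W1: "(exp 1 - 1) * norm W \<le> error_const R B m M"
    unfolding err by (rule mult_left_mono[OF W]) (use e1 in simp)
  \<comment> \<open>Because \<open>exp 1 - 1 \<ge> 1\<close>, the hypothesis on
    \<open>error_const\<close> also bounds \<open>norm W\<close> itself by 1, as the exponential
    estimate demands.\<close>
  then have "norm W \<le> 1"
    using assms(10) mult_right_mono[OF e1 norm_ge_zero[of W]] by linarith
  then have "norm (exp W - 1) \<le> error_const R B m M"
    by (rule order_trans[OF norm_exp_minus_one_le W1])
  then have "norm ((exp W - 1) * zeta_prod \<alpha> m M) \<le> error_const R B m M * norm (zeta_prod \<alpha> m M)"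
    unfolding norm_mult by (rule mult_right_mono) simp
  then have "norm ((\<Prod>k. f (1 / of_nat (q k))) - zeta_prod \<alpha> m M)
      \<le> error_const R B m M * norm (zeta_prod \<alpha> m M)"
    unfolding prod split left_diff_distrib mult_1_left .
  with conv show ?thesis unfolding q_def by (rule conjI)
qed

end
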